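(* $$\sum_{n=0}^{\infty}\frac{\binom{2n}{n}}{2^{4n}(2n+1)^3}=\frac{7\pi^3}{216}.$$
   Context: Here $\binom{2n}{n}$ is the central binomial coefficient. *)

theory Defs
  imports "HOL-Analysis.Analysis"
begin

end

theory Submission
  imports Defs "HOL-Complex_Analysis.Complex_Analysis" "HOL-Real_Asymp.Real_Asymp"
begin

text \<open>
  Since \<open>arcsin x\<close> has the expansion \<open>\<Sum>n. c\<^sub>n x ^ (2n+1) / (2n+1)\<close> with
  \<open>c\<^sub>n = ((2n) choose n) / 4 ^ n\<close>, the series is \<open>2 F\<^sub>3(1/2)\<close>, where \<open>F\<^sub>k\<close> arises from \<open>F\<^sub>1 = arcsin\<close>
  by \<open>x F\<^bsub>k+1\<^esub>' = F\<^sub>k\<close>. Substituting \<open>x = sin t\<close> and integrating by parts twice turns it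
  into the integral of \<open>(ln (2 sin t))\<^sup>2\<close> over \<open>(0, pi/6)\<close>; here this is expressed by the explicit
  antiderivative of \<open>log_sine_primitive_deriv\<close>, which vanishes at \<open>0\<close> and equals
  \<open>2 F\<^sub>3(1/2)\<close> at \<open>pi/6\<close>, because the factor \<open>ln (2 sin t)\<close> is zero there.

  A second antiderivative comes from complex analysis. Because
  \<open>Ln (1 - cis (2t)) = ln (2 sin t) - \<i> (pi/2 - t)\<close>, the integrand is, up to the polynomial
  \<open>(pi/2 - t)\<^sup>2\<close>, half the derivative of \<open>Im H\<close> along the unit circle, where \<open>H\<close> is the
  primitive of \<open>(Ln (1 - z))\<^sup>2 / z\<close> on the half-plane \<open>Re z < 1\<close> with \<open>H 0 = 0\<close>
  (\<open>primitive_unit_circle_deriv\<close>). It remains to know \<open>Im H\<close> at both ends of the arc from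
  \<open>1\<close> to \<open>cis (pi/3)\<close>. Near \<open>1\<close> it tends to \<open>0\<close>, since \<open>H\<close> is real on \<open>[0,1)\<close> and the singularity
  of the kernel is only logarithmic (\<open>primitive_tendsto\<close>). The point \<open>cis (pi/3)\<close> is fixed by the
  reflection taking \<open>z\<close> to the conjugate of \<open>1 - z\<close>, so it is also reached from \<open>0\<close> along the circle
  \<open>|1 - z| = 1\<close>. On that circle \<open>Ln (1 - z)\<close> is purely imaginary and linear in the angle, and
  \<open>Im H\<close> becomes a cubic polynomial (\<open>primitive_at_sixth_root\<close>). Comparing the two
  antiderivatives gives \<open>pi ^ 3 / 24 - pi ^ 3 / 81 + pi ^ 3 / 324\<close>.
\<close>

section \<open>The arcsine series and its iterated logarithmic integrals\<close>

lemma odd_powser_sums: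
  fixes a :: "nat \<Rightarrow> real"
  assumes a: "\<And>n. \<bar>a n\<bar> \<le> 1" and x: "\<bar>x\<bar> < 1"
  shows "(\<lambda>n. a n * x ^ (2*n+1)) sums (\<Sum>n. a n * x ^ (2*n+1))"
proof -
  have "summable (\<lambda>n. \<bar>x\<bar> ^ (2*n+1))"
    using x by (simp add: power_mult abs_square_less_1 summable_geometric summable_mult)
  then have "summable (\<lambda>n. a n * x ^ (2*n+1))"
  proof (rule summable_comparison_test[rotated], intro exI allI impI)
    fix n
    show "norm (a n * x ^ (2*n+1)) \<le> \<bar>x\<bar> ^ (2*n+1)"
      using mult_right_mono[OF a, of "\<bar>x\<bar> ^ (2*n+1)" n] by (simp add: abs_mult power_abs)
  qed
  then show ?thesis by (rule summable_sums)
qed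

lemma odd_powser_has_derivative:
  fixes a :: "nat \<Rightarrow> real"
  assumes a: "\<And>n. \<bar>a n\<bar> \<le> 1" and x: "\<bar>x\<bar> < 1"
  shows "((\<lambda>x. \<Sum>n. a n * x ^ (2*n+1)) has_real_derivative
          (\<Sum>n. (2 * real n + 1) * a n * x ^ (2*n))) (at x)"
proof -
  define c where "c = (\<lambda>m. if odd m then a (m div 2) else 0)"
  have c_le: "\<bar>c m\<bar> \<le> 1" for m using a by (simp add: c_def)
  have F: "(\<Sum>n. a n * y ^ (2*n+1)) = (\<Sum>m. c m * y ^ m)" for y
    by (subst suminf_mono_reindex[of "\<lambda>n. 2*n+1", symmetric])
       (auto elim!: oddE simp: strict_mono_def c_def)
  have F': "(\<Sum>n. (2 * real n + 1) * a n * x ^ (2*n)) = (\<Sum>m. diffs c m * x ^ m)"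
    by (subst suminf_mono_reindex[of "\<lambda>n. 2*n", symmetric])
       (auto elim!: evenE simp: strict_mono_def c_def diffs_def add_ac)
  have "((\<lambda>x. \<Sum>m. c m * x ^ m) has_real_derivative (\<Sum>m. diffs c m * x ^ m)) (at x)"
  proof (rule termdiffs_strong'[where K = 1])
    fix z :: real assume z: "norm z < 1"
    show "summable (\<lambda>n. c n * z ^ n)"
    proof (rule summable_comparison_test, intro exI allI impI)
      show "summable (\<lambda>n. \<bar>z\<bar> ^ n)" using z by simp
      show "norm (c n * z ^ n) \<le> \<bar>z\<bar> ^ n" for n
        using mult_right_mono[OF c_le, of "\<bar>z\<bar> ^ n" n] by (simp add: abs_mult power_abs)
    qed
  qed (use x in simp)
  then show ?thesis by (simp only: F F')
qed

definition central :: "nat \<Rightarrow> real" where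
  "central n = real ((2*n) choose n) / 4 ^ n"

text \<open>
  This identifies the coefficients with those of the binomial series of \<open>(1 - y) powr (-1/2)\<close>;
  both sides obey \<open>(n + 1) u\<^bsub>n+1\<^esub> = (n + 1/2) u\<^sub>n\<close>.
\<close>

lemma central_eq_gbinomial: "central n = (-1) ^ n * ((-1/2) gchoose n)"
proof (induction n)
  case 0
  then show ?case by (simp add: central_def)
next
  case (Suc n)
  have a: "Suc n * (Suc (Suc (2*n)) choose Suc n) = Suc (Suc (2*n)) * (Suc (2*n) choose n)"
    by (rule Suc_times_binomial_eq[symmetric, simplified mult.commute])
  have b: "(Suc (2*n) choose n) * Suc n = Suc (2*n) * ((2*n) choose n)"
    using Suc_times_binomial_eq[of "2*n" n] binomial_symmetric[of n "Suc (2*n)"]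
    by (simp add: mult.commute)
  have "(Suc n * (Suc (Suc (2*n)) choose Suc n)) * Suc n
      = Suc (Suc (2*n)) * ((Suc (2*n) choose n) * Suc n)"
    unfolding a by (simp only: mult_ac)
  also have "\<dots> = 2 * Suc n * Suc (2*n) * ((2*n) choose n)"
    unfolding b by (simp add: algebra_simps)
  finally have "Suc n * (Suc (Suc (2*n)) choose Suc n) = 2 * Suc (2*n) * ((2*n) choose n)"
    by (metis (no_types, lifting) mult.assoc mult.commute mult_cancel1 nat.distinct(1))
  then have "real (Suc n) * real ((2 * Suc n) choose Suc n)
      = 2 * (2 * real n + 1) * real ((2*n) choose n)"
    by (metis (no_types, lifting) mult_2 add_Suc add_Suc_right of_nat_mult of_nat_numeral
        of_nat_Suc of_nat_add add.commute)
  then have 1: "(real n + 1) * central (Suc n) = (real n + 1/2) * central n"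
    by (simp add: central_def field_simps)
  have 2: "(real n + 1) * ((-1/2::real) gchoose Suc n) = (-1/2 - real n) * ((-1/2) gchoose n)"
    using gbinomial_mult_1[of "-1/2::real" n] by (simp add: algebra_simps)
  have "(real n + 1) * central (Suc n) = (real n + 1) * ((-1) ^ Suc n * ((-1/2) gchoose Suc n))"
    unfolding 1 Suc.IH mult.left_commute[of "real n + 1"] 2 by (simp add: algebra_simps)
  then show ?case by (smt (verit) mult_cancel_left of_nat_0_le_iff)
qed

lemma central_bounds: "0 \<le> central n" "central n \<le> 1"
proof -
  have "(2*n) choose n \<le> 2 ^ (2*n)" by (rule binomial_le_pow2)
  also have "\<dots> = (4::nat) ^ n" by (simp add: power_mult)
  finally have "real ((2*n) choose n) \<le> 4 ^ n"
    by (metis of_nat_le_iff of_nat_numeral of_nat_power)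
  then show "0 \<le> central n" "central n \<le> 1" by (simp_all add: central_def)
qed

lemma central_powser:
  assumes "\<bar>x\<bar> < 1"
  shows "(\<lambda>n. central n * x ^ (2*n)) sums (1 / sqrt (1 - x\<^sup>2))"
proof -
  have *: "\<bar>- (x\<^sup>2)\<bar> < 1" using assms by (simp add: abs_square_less_1)
  have "((-1/2) gchoose n) * (- (x\<^sup>2)) ^ n = central n * x ^ (2*n)" for n
    by (simp add: central_eq_gbinomial power_mult power_minus[of "x\<^sup>2"])
  moreover have "(1 + - (x\<^sup>2)) powr (-1/2) = 1 / sqrt (1 - x\<^sup>2)"
    using * by (simp add: powr_minus_divide powr_half_sqrt)
  ultimately show ?thesis using gen_binomial_real[OF *, of "-1/2"] by simp
qed

text \<open>
  With \<open>k = 1\<close> this is the Taylor series of the arcsine. Raising \<open>k\<close> by one amounts to integrating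
  against \<open>dx / x\<close>.
\<close>

definition arcsin_series :: "nat \<Rightarrow> real \<Rightarrow> real" where
  "arcsin_series k x = (\<Sum>n. central n / (2 * real n + 1) ^ k * x ^ (2*n+1))"

lemma arcsin_coeff_bound: "\<bar>central n / (2 * real n + 1) ^ k\<bar> \<le> 1"
  using central_bounds[of n] order_trans[OF central_bounds(2) one_le_power[of "2 * real n + 1" k]]
  by (simp add: divide_le_eq_1)

lemma arcsin_series_sums:
  assumes "\<bar>x\<bar> < 1"
  shows "(\<lambda>n. central n / (2 * real n + 1) ^ k * x ^ (2*n+1)) sums arcsin_series k x"
  unfolding arcsin_series_def by (rule odd_powser_sums[OF arcsin_coeff_bound assms])

lemma arcsin_series_has_derivative_powser:
  assumes "\<bar>x\<bar> < 1"
  shows "(arcsin_series (Suc k) has_real_derivative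
          (\<Sum>n. central n / (2 * real n + 1) ^ k * x ^ (2*n))) (at x)"
proof -
  have "(2 * real n + 1) * (central n / (2 * real n + 1) ^ Suc k) =
        central n / (2 * real n + 1) ^ k" for n
    by (simp add: add_nonneg_eq_0_iff)
  with odd_powser_has_derivative[where a = "\<lambda>n. central n / (2 * real n + 1) ^ Suc k",
      OF arcsin_coeff_bound assms]
  show ?thesis by (simp only: arcsin_series_def[abs_def])
qed

lemma arcsin_series_has_derivative:
  assumes "0 < x" "x < 1"
  shows "(arcsin_series (Suc k) has_real_derivative arcsin_series k x / x) (at x)"
proof -
  have "(\<lambda>n. central n / (2 * real n + 1) ^ k * x ^ (2*n+1) / x) sums (arcsin_series k x / x)"
    using assms by (intro sums_divide arcsin_series_sums) auto
  then have "(\<Sum>n. central n / (2 * real n + 1) ^ k * x ^ (2*n)) = arcsin_series k x / x"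
    using assms by (simp add: sums_iff)
  with arcsin_series_has_derivative_powser[of x k] assms show ?thesis by simp
qed

lemma arcsin_series_1:
  assumes "0 \<le> x" "x < 1"
  shows "arcsin_series 1 x = arcsin x"
proof -
  have "((\<lambda>x. arcsin_series 1 x - arcsin x) has_real_derivative 0) (at y within {0..<1})"
    if "y \<in> {0..<1}" for y
  proof -
    have "(arcsin_series 1 has_real_derivative 1 / sqrt (1 - y\<^sup>2)) (at y)"
      using arcsin_series_has_derivative_powser[of y 0] central_powser[of y] that by (simp add: sums_iff)
    moreover have "(arcsin has_real_derivative inverse (sqrt (1 - y\<^sup>2))) (at y)"
      using that by (intro DERIV_arcsin) auto
    ultimately show ?thesis
      using DERIV_diff has_field_derivative_at_within by (fastforce simp: inverse_eq_divide)
  qed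
  then obtain c where c: "\<And>y. y \<in> {0..<1} \<Longrightarrow> arcsin_series 1 y - arcsin y = c"
    using has_field_derivative_zero_constant[of "{0..<1}" "\<lambda>x. arcsin_series 1 x - arcsin x"]
    by auto
  moreover have "arcsin_series 1 0 = 0" by (simp add: arcsin_series_def)
  ultimately show ?thesis using c[of 0] c[of x] assms by simp
qed

text \<open>
  All coefficients are nonnegative and decrease with \<open>k\<close>, so every series is dominated by the
  arcsine. At \<open>x = sin t\<close> the bound reads \<open>t\<close>, which is small enough to absorb the factor
  \<open>ln (2 sin t)\<close> as \<open>t\<close> tends to \<open>0\<close>.
\<close>

lemma arcsin_series_bounds:
  assumes "0 \<le> x" "x < 1"
  shows "0 \<le> arcsin_series (Suc k) x" "arcsin_series (Suc k) x \<le> arcsin x"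
proof -
  have s: "(\<lambda>n. central n / (2 * real n + 1) ^ j * x ^ (2*n+1)) sums arcsin_series j x" for j
    using assms by (intro arcsin_series_sums) auto
  show "0 \<le> arcsin_series (Suc k) x"
    by (rule sums_le[OF _ sums_zero s]) (use assms central_bounds in auto)
  have "arcsin_series (Suc k) x \<le> arcsin_series 1 x"
  proof (rule sums_le[OF _ s s])
    fix n
    have "(2 * real n + 1) ^ 1 \<le> (2 * real n + 1) ^ Suc k"
      by (intro power_increasing) auto
    then show "central n / (2 * real n + 1) ^ Suc k * x ^ (2*n+1)
             \<le> central n / (2 * real n + 1) ^ 1 * x ^ (2*n+1)"
      using assms central_bounds by (intro mult_right_mono divide_left_mono) auto
  qed
  then show "arcsin_series (Suc k) x \<le> arcsin x" using arcsin_series_1 assms by simp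
qed

section \<open>A real antiderivative of the squared log-sine\<close>

text \<open>
  The form arises by integrating \<open>(ln (2 sin t))\<^sup>2\<close> by parts: differentiating the factor
  \<open>ln (2 sin t)\<close> produces \<open>cot t\<close>, and \<open>cot t dt\<close> is \<open>dx / x\<close> for \<open>x = sin t\<close>, so each
  step raises the index of the arcsine series.
\<close>

definition log_sine_primitive :: "real \<Rightarrow> real" where
  "log_sine_primitive t = 2 * arcsin_series 3 (sin t)
     - 2 * ln (2 * sin t) * arcsin_series 2 (sin t) + t * (ln (2 * sin t))\<^sup>2"

lemma log_sine_primitive_deriv:
  assumes "0 < t" "t < pi / 2"
  shows "(log_sine_primitive has_real_derivative (ln (2 * sin t))\<^sup>2) (at t)"
proof -
  have s: "0 < sin t" "sin t < 1"
    using assms sin_gt_zero[of t] sin_monotone_2pi[of t "pi/2"] by auto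
  have D: "((\<lambda>t. arcsin_series (Suc k) (sin t)) has_real_derivative
            arcsin_series k (sin t) / sin t * cos t) (at t)" for k
    using DERIV_chain2[where f = "arcsin_series (Suc k)" and g = sin,
      OF arcsin_series_has_derivative[OF s] DERIV_sin] .
  have D2: "((\<lambda>t. arcsin_series 2 (sin t)) has_real_derivative t / sin t * cos t) (at t)"
    using D[of 1] arcsin_series_1[of "sin t"] s assms
    by (simp add: arcsin_sin numeral_2_eq_2)
  have D3: "((\<lambda>t. arcsin_series 3 (sin t)) has_real_derivative
            arcsin_series 2 (sin t) / sin t * cos t) (at t)"
    using D[of 2] by (simp add: numeral_3_eq_3 numeral_2_eq_2)
  show ?thesis unfolding log_sine_primitive_def[abs_def]
    by (rule derivative_eq_intros D2 D3 refl
        | use s in \<open>simp add: field_simps power2_eq_square; fail\<close>)+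
qed

lemma log_sine_primitive_tendsto: "(log_sine_primitive \<longlongrightarrow> 0) (at_right 0)"
proof -
  have ev: "eventually (\<lambda>t::real. t \<in> {0<..<pi/2}) (at_right 0)"
    by (rule eventually_at_right_real) simp
  have b: "0 \<le> arcsin_series (Suc k) (sin t)" "arcsin_series (Suc k) (sin t) \<le> t"
    if "t \<in> {0<..<pi/2}" for t k
  proof -
    have s: "0 < sin t" "sin t < 1"
      using that sin_gt_zero[of t] sin_monotone_2pi[of t "pi/2"] by auto
    then show "0 \<le> arcsin_series (Suc k) (sin t)" "arcsin_series (Suc k) (sin t) \<le> t"
      using arcsin_series_bounds[of "sin t" k] that by (auto simp: arcsin_sin)
  qed
  have "((\<lambda>t. 2 * t + 2 * \<bar>ln (2 * sin t)\<bar> * t + t * (ln (2 * sin t))\<^sup>2) \<longlongrightarrow> 0) (at_right (0::real))"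
    by real_asymp
  then show ?thesis
  proof (rule Lim_null_comparison[rotated])
    show "\<forall>\<^sub>F t in at_right 0. norm (log_sine_primitive t)
        \<le> 2 * t + 2 * \<bar>ln (2 * sin t)\<bar> * t + t * (ln (2 * sin t))\<^sup>2"
      using ev
    proof eventually_elim
      case (elim t)
      have "\<bar>2 * arcsin_series 3 (sin t)\<bar> \<le> 2 * t"
        using b[OF elim, of 2] by (simp add: numeral_3_eq_3 numeral_2_eq_2)
      moreover have "\<bar>2 * ln (2 * sin t) * arcsin_series 2 (sin t)\<bar> \<le> 2 * \<bar>ln (2 * sin t)\<bar> * t"
        using b[OF elim, of 1] by (auto simp: abs_mult numeral_2_eq_2 intro!: mult_left_mono)
      moreover have "\<bar>t * (ln (2 * sin t))\<^sup>2\<bar> \<le> t * (ln (2 * sin t))\<^sup>2"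
        using elim by (simp add: abs_mult)
      ultimately show ?case unfolding log_sine_primitive_def real_norm_def by linarith
    qed
  qed
qed

section \<open>A holomorphic primitive of the squared logarithm\<close>

text \<open>
  The numerator has a double zero at \<open>0\<close>, so the singularity is removable with value \<open>0\<close>, which
  is also what division by zero yields here.
\<close>

definition log_kernel :: "complex \<Rightarrow> complex" where
  "log_kernel z = (Ln (1 - z))\<^sup>2 / z"

lemma log_kernel_holomorphic: "log_kernel holomorphic_on {z. Re z < 1}"
proof -
  define f where "f = (\<lambda>z::complex. (Ln (1 - z))\<^sup>2)"
  have nonpos: "1 - z \<notin> \<real>\<^sub>\<le>\<^sub>0" if "Re z < 1" for z
    using that by (auto simp: complex_nonpos_Reals_iff)
  have "(f has_field_derivative 0) (at 0)"
    unfolding f_def by (auto intro!: derivative_eq_intros)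
  then have d: "deriv f 0 = 0" by (rule DERIV_imp_deriv)
  have "f holomorphic_on {z. Re z < 1}"
    unfolding f_def using nonpos by (auto intro!: holomorphic_intros)
  then have "(\<lambda>z. if z = 0 then deriv f 0 else (f z - f 0) / (z - 0)) holomorphic_on {z. Re z < 1}"
    by (rule pole_lemma_open) (rule open_halfspace_Re_lt)
  also have "(\<lambda>z. if z = 0 then deriv f 0 else (f z - f 0) / (z - 0)) = log_kernel"
    unfolding d by (auto simp: f_def log_kernel_def)
  finally show ?thesis .
qed

lemma log_kernel_primitive:
  "\<exists>H. (\<forall>z. Re z < 1 \<longrightarrow> (H has_field_derivative log_kernel z) (at z)) \<and> H 0 = 0"
proof -
  obtain G where G: "\<And>z. z \<in> {z. Re z < 1} \<Longrightarrow>
      (G has_field_derivative log_kernel z) (at z within {z. Re z < 1})"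
    using holomorphic_convex_primitive'[OF convex_halfspace_Re_lt open_halfspace_Re_lt
        log_kernel_holomorphic] by blast
  have "((\<lambda>z. G z - G 0) has_field_derivative log_kernel z) (at z)" if "Re z < 1" for z
    using G[of z] that at_within_open[OF _ open_halfspace_Re_lt, of z 1]
    by (auto intro!: derivative_eq_intros)
  then show ?thesis by (intro exI[of _ "\<lambda>z. G z - G 0"]) simp
qed

lemma Im_along_path_has_derivative:
  assumes "(p has_vector_derivative p') (at t)" "(H has_field_derivative h) (at (p t))"
  shows "((\<lambda>t. Im (H (p t))) has_real_derivative Im (p' * h)) (at t)"
proof -
  have "((\<lambda>t. Im ((H \<circ> p) t)) has_vector_derivative Im (p' * h)) (at t)"
    by (rule bounded_linear.has_vector_derivative[OF bounded_linear_Im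
          field_vector_diff_chain_at[OF assms]])
  then show ?thesis by (simp add: has_real_derivative_iff_has_vector_derivative)
qed

lemma cis_has_vector_derivative:
  "((\<lambda>t. cis (c * t)) has_vector_derivative (of_real c * \<i> * cis (c * t))) (at t)"
  unfolding has_vector_derivative_complex_iff
  by (auto intro!: derivative_eq_intros)

lemma constant_on_interval:
  fixes f :: "real \<Rightarrow> real"
  assumes "\<And>x. a \<le> x \<Longrightarrow> x \<le> b \<Longrightarrow> (f has_real_derivative 0) (at x)" "a \<le> b"
  shows "f a = f b"
proof -
  have "(f has_real_derivative 0) (at x within {a..b})" if "x \<in> {a..b}" for x
    using assms(1)[of x] that by (simp add: has_field_derivative_at_within)
  then have "\<exists>c. \<forall>x\<in>{a..b}. f x = c"
    by (intro has_field_derivative_zero_constant) auto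
  then obtain c where "\<And>x. x \<in> {a..b} \<Longrightarrow> f x = c" by blast
  then show ?thesis using assms(2) by simp
qed

text \<open>The kernel is real on \<open>[0,1)\<close>, hence so is its primitive along that segment.\<close>

lemma primitive_real:
  assumes H: "\<And>z. Re z < 1 \<Longrightarrow> (H has_field_derivative log_kernel z) (at z)" "H 0 = 0"
    and x: "0 \<le> x" "x < 1"
  shows "Im (H (of_real x)) = 0"
proof -
  have "Im (H (of_real 0)) = Im (H (of_real x))"
  proof (rule constant_on_interval[where f = "\<lambda>t. Im (H (of_real t))"])
    fix t :: real assume t: "0 \<le> t" "t \<le> x"
    have "Ln (1 - of_real t) = of_real (ln (1 - t))"
      using t x by (metis Ln_of_real diff_gt_0_iff_gt le_less_trans of_real_1 of_real_diff)
    then have "Im (1 * log_kernel (of_real t)) = 0"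
      unfolding log_kernel_def by (simp flip: of_real_power of_real_divide)
    moreover have "((\<lambda>t. Im (H (of_real t))) has_real_derivative
        Im (1 * log_kernel (of_real t))) (at t)"
    proof -
      have "(complex_of_real has_vector_derivative 1) (at t)"
        using has_vector_derivative_real_field[OF DERIV_ident, of "of_real t" UNIV] by simp
      moreover have "(H has_field_derivative log_kernel (of_real t)) (at (of_real t))"
        using t x by (intro H) simp
      ultimately show ?thesis by (rule Im_along_path_has_derivative)
    qed
    ultimately show "((\<lambda>t. Im (H (of_real t))) has_real_derivative 0) (at t)" by simp
  qed (use x in auto)
  then show ?thesis using H by simp
qed

text \<open>
  The path \<open>p t = 1 - cis (-t)\<close> runs from \<open>0\<close> to \<open>cis (pi/3)\<close>. On it \<open>Ln (1 - p t) = -\<i> t\<close>, and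
  \<open>cis (-t) / p t\<close> has the constant real part \<open>-1/2\<close>, so the imaginary part of the integrand
  is \<open>t\<^sup>2 / 2\<close>.
\<close>

lemma primitive_at_sixth_root:
  assumes H: "\<And>z. Re z < 1 \<Longrightarrow> (H has_field_derivative log_kernel z) (at z)" "H 0 = 0"
  shows "Im (H (cis (pi / 3))) = pi ^ 3 / 162"
proof -
  define p where "p = (\<lambda>t. 1 - cis (- 1 * t))"
  have "Im (H (p 0)) - 0 ^ 3 / 6 = Im (H (p (pi/3))) - (pi/3) ^ 3 / 6"
  proof (rule constant_on_interval[where f = "\<lambda>t. Im (H (p t)) - t ^ 3 / 6"])
    fix t :: real assume t: "0 \<le> t" "t \<le> pi / 3"
    have "- (pi / 2) < t" "t < pi / 2" using t pi_gt_zero by linarith+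
    then have "cos t > 0" by (rule cos_gt_zero_pi)
    then have Re: "Re (p t) < 1" by (simp add: p_def)
    have p': "(p has_vector_derivative (\<i> * cis (- t))) (at t)"
      using has_vector_derivative_diff[OF has_vector_derivative_const cis_has_vector_derivative,
          of 1 "-1" t]
      by (simp add: p_def)
    have "Ln (1 - p t) = - \<i> * t"
      by (rule Ln_unique) (use t \<open>t < pi / 2\<close> in \<open>auto simp: p_def cis_conv_exp\<close>)
    then have k: "log_kernel (p t) = - (t\<^sup>2) / p t"
      by (simp add: log_kernel_def power_mult_distrib)
    have "Im (\<i> * cis (- t) * log_kernel (p t)) = t\<^sup>2 / 2"
    proof (cases "t = 0")
      case False
      then have "cos t < 1" using t cos_monotone_0_pi[of 0 t] by auto
      moreover have "sin t * sin t = (1 - cos t) * (1 + cos t)"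
        using sin_cos_squared_add[of t] by (simp add: power2_eq_square algebra_simps)
      ultimately have "cis (- t) = p t * Complex (- 1 / 2) (- sin t / (2 * (1 - cos t)))"
        by (simp add: p_def complex_eq_iff) (simp add: field_simps)
      moreover have "p t \<noteq> 0" using \<open>cos t < 1\<close> by (simp add: p_def complex_eq_iff)
      ultimately have "cis (- t) * log_kernel (p t)
          = - of_real (t\<^sup>2) * Complex (- 1 / 2) (- sin t / (2 * (1 - cos t)))"
        unfolding k by simp
      then show ?thesis by (simp add: mult.assoc)
    qed (simp add: log_kernel_def p_def)
    then have "((\<lambda>t. Im (H (p t))) has_real_derivative t\<^sup>2 / 2) (at t)"
      using Im_along_path_has_derivative[OF p' H(1)[OF Re]] by (simp only:)
    moreover have "((\<lambda>t. t ^ 3 / 6) has_real_derivative t\<^sup>2 / 2) (at t)"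
      by (auto intro!: derivative_eq_intros)
    ultimately show "((\<lambda>t. Im (H (p t)) - t ^ 3 / 6) has_real_derivative 0) (at t)"
      using DERIV_diff by fastforce
  qed auto
  moreover have "p (pi / 3) = cis (pi / 3)"
    by (simp add: p_def complex_eq_iff cos_60 sin_60)
  moreover have "p 0 = 0" by (simp add: p_def)
  ultimately show ?thesis using H by (simp add: power_divide)
qed

text \<open>
  The factor \<open>cis (2t)\<close> of the velocity cancels the denominator of the kernel, and
  \<open>1 - cis (2t) = 2 sin t * cis (t - pi/2)\<close> gives the logarithm explicitly.
\<close>

lemma primitive_unit_circle_deriv:
  assumes H: "\<And>z. Re z < 1 \<Longrightarrow> (H has_field_derivative log_kernel z) (at z)"
    and t: "0 < t" "t < pi / 2"
  shows "((\<lambda>t. Im (H (cis (2 * t)))) has_real_derivative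
           2 * ((ln (2 * sin t))\<^sup>2 - (pi / 2 - t)\<^sup>2)) (at t)"
proof -
  have s: "sin t > 0" using t by (intro sin_gt_zero) auto
  have "cos (2 * t) < 1" using t cos_monotone_0_pi[of 0 "2*t"] by auto
  then have "((\<lambda>t. Im (H (cis (2 * t)))) has_real_derivative
      Im (of_real 2 * \<i> * cis (2 * t) * log_kernel (cis (2 * t)))) (at t)"
    by (intro Im_along_path_has_derivative cis_has_vector_derivative H) simp
  moreover have "Ln (1 - cis (2 * t)) = Complex (ln (2 * sin t)) (t - pi / 2)"
  proof (rule Ln_unique)
    have "exp (Complex (ln (2 * sin t)) (t - pi / 2)) = of_real (2 * sin t) * cis (t - pi / 2)"
      using s by (simp add: exp_eq_polar)
    also have "\<dots> = 1 - cis (2 * t)"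
      by (simp add: complex_eq_iff cos_diff sin_diff cos_double_sin sin_double power2_eq_square)
    finally show "exp (Complex (ln (2 * sin t)) (t - pi / 2)) = 1 - cis (2 * t)" .
  qed (use t in auto)
  then have "of_real 2 * \<i> * cis (2 * t) * log_kernel (cis (2 * t))
      = 2 * \<i> * (Complex (ln (2 * sin t)) (t - pi / 2))\<^sup>2"
    by (simp add: log_kernel_def)
  then have "Im (of_real 2 * \<i> * cis (2 * t) * log_kernel (cis (2 * t)))
      = 2 * ((ln (2 * sin t))\<^sup>2 - (pi / 2 - t)\<^sup>2)"
    by (simp add: power2_eq_square algebra_simps)
  ultimately show ?thesis by simp
qed

text \<open>
  The bound compares \<open>cis a\<close> with its projection \<open>cos a\<close> on the real axis, where \<open>Im H\<close> vanishes.
  On the vertical segment between them the kernel is at most the squared logarithm of the distance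
  \<open>1 - cos a\<close> to the singular point \<open>1\<close>, up to constants, while the length \<open>sin a\<close> of the segment
  tends to \<open>0\<close> faster.
  The restriction \<open>a < pi/3\<close> keeps \<open>|1 - z| \<le> 1\<close>, which fixes the sign of the logarithm.
\<close>

lemma primitive_bound:
  assumes H: "\<And>z. Re z < 1 \<Longrightarrow> (H has_field_derivative log_kernel z) (at z)" "H 0 = 0"
    and a: "0 < a" "a < pi / 3"
  shows "\<bar>Im (H (cis a))\<bar> \<le> (pi - ln (1 - cos a))\<^sup>2 / cos a * sin a"
proof -
  have c: "1 / 2 < cos a" "cos a < 1"
    using a cos_monotone_0_pi[of a "pi/3"] cos_monotone_0_pi[of 0 a] by (auto simp: cos_60)
  have s: "0 < sin a" using a by (intro sin_gt_zero) auto
  define S where "S = closed_segment (of_real (cos a)) (cis a)"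
  have S: "Re z = cos a" "0 \<le> Im z" "Im z \<le> sin a" if zS: "z \<in> S" for z
  proof -
    obtain u where u: "0 \<le> u" "u \<le> 1" "z = (1 - u) *\<^sub>R of_real (cos a) + u *\<^sub>R cis a"
      using zS unfolding S_def in_segment by blast
    show "Re z = cos a" "0 \<le> Im z" unfolding u(3) using u s by (simp_all add: algebra_simps)
    show "Im z \<le> sin a" unfolding u(3) using u s by (simp add: mult_left_le_one_le)
  qed
  have "norm (H (cis a) - H (of_real (cos a)))
      \<le> (pi - ln (1 - cos a))\<^sup>2 / cos a * norm (cis a - of_real (cos a))"
  proof (rule field_differentiable_bound[where S = S and f' = log_kernel])
    fix z assume "z \<in> S"
    note z = S[OF this]
    show "(H has_field_derivative log_kernel z) (at z within S)"
      using H(1)[of z] z c by (simp add: has_field_derivative_at_within)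
    have nz: "1 - z \<noteq> 0" using z c by auto
    have lo: "1 - cos a \<le> norm (1 - z)" using complex_Re_le_cmod[of "1 - z"] z by simp
    have "(norm (1 - z))\<^sup>2 = (1 - cos a)\<^sup>2 + (Im z)\<^sup>2" unfolding cmod_power2 using z by simp
    also have "\<dots> \<le> (1 - cos a)\<^sup>2 + (sin a)\<^sup>2" using z by (simp add: power_mono)
    also have "\<dots> = 2 - 2 * cos a"
      using sin_cos_squared_add[of a] by (simp add: power2_eq_square algebra_simps)
    also have "\<dots> \<le> 1\<^sup>2" using c by simp
    finally have hi: "norm (1 - z) \<le> 1" by (rule power2_le_imp_le) simp
    have "norm (Ln (1 - z)) \<le> \<bar>ln (norm (1 - z))\<bar> + \<bar>Im (Ln (1 - z))\<bar>"
      using cmod_le[of "Ln (1 - z)"] nz by simp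
    also have "\<bar>Im (Ln (1 - z))\<bar> \<le> pi"
      using mpi_less_Im_Ln[OF nz] Im_Ln_le_pi[OF nz] by simp
    also have "\<bar>ln (norm (1 - z))\<bar> \<le> - ln (1 - cos a)"
      using lo hi nz c by simp
    finally have "norm (Ln (1 - z)) \<le> pi - ln (1 - cos a)" by simp
    moreover have "cos a \<le> norm z" using complex_Re_le_cmod[of z] z by simp
    ultimately show "norm (log_kernel z) \<le> (pi - ln (1 - cos a))\<^sup>2 / cos a"
      using c unfolding log_kernel_def norm_divide norm_power
      by (intro frac_le power_mono) auto
  qed (auto simp: S_def)
  also have "cis a - of_real (cos a) = \<i> * of_real (sin a)" by (simp add: complex_eq_iff)
  finally have "norm (H (cis a) - H (of_real (cos a)))
      \<le> (pi - ln (1 - cos a))\<^sup>2 / cos a * sin a" using s by (simp add: norm_mult)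
  moreover have "Im (H (of_real (cos a))) = 0" using c by (intro primitive_real H) auto
  ultimately show ?thesis
    using abs_Im_le_cmod[of "H (cis a) - H (of_real (cos a))"] by simp
qed

lemma primitive_tendsto:
  assumes H: "\<And>z. Re z < 1 \<Longrightarrow> (H has_field_derivative log_kernel z) (at z)" "H 0 = 0"
  shows "((\<lambda>t. Im (H (cis (2 * t)))) \<longlongrightarrow> 0) (at_right 0)"
proof (rule Lim_null_comparison)
  have "eventually (\<lambda>t::real. t \<in> {0<..<pi/6}) (at_right 0)"
    by (rule eventually_at_right_real) simp
  then show "\<forall>\<^sub>F t in at_right 0. norm (Im (H (cis (2 * t))))
      \<le> (pi - ln (1 - cos (2 * t)))\<^sup>2 / cos (2 * t) * sin (2 * t)"
    by eventually_elim (use primitive_bound[OF H] in auto)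
  show "((\<lambda>t. (pi - ln (1 - cos (2 * t)))\<^sup>2 / cos (2 * t) * sin (2 * t)) \<longlongrightarrow> 0) (at_right (0::real))"
    by real_asymp
qed

section \<open>Evaluation of the series\<close>

theorem mainTheorem1:
  shows "(\<lambda>n::nat. real ((2 * n) choose n) / (2 ^ (4 * n) * (2 * real n + 1) ^ 3)) sums (7 * pi ^ 3 / 216)"
proof -
  obtain H where H: "\<And>z. Re z < 1 \<Longrightarrow> (H has_field_derivative log_kernel z) (at z)" "H 0 = 0"
    using log_kernel_primitive by blast
  \<comment> \<open>the difference of the two antiderivatives of \<open>(ln (2 * sin t))\<^sup>2\<close>\<close>
  define D where "D = (\<lambda>t. log_sine_primitive t - Im (H (cis (2 * t))) / 2 + (pi / 2 - t) ^ 3 / 3)"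
  have D_const: "D t = D (pi / 6)" if "0 < t" "t \<le> pi / 6" for t
  proof (rule constant_on_interval[where f = D])
    fix u assume "t \<le> u" "u \<le> pi / 6"
    with that have u: "0 < u" "u < pi / 2" using pi_gt_zero by linarith+
    have "((\<lambda>t. (pi / 2 - t) ^ 3 / 3) has_real_derivative - (pi / 2 - u)\<^sup>2) (at u)"
      by (auto intro!: derivative_eq_intros)
    from DERIV_add[OF DERIV_diff[OF log_sine_primitive_deriv[OF u]
          DERIV_cdivide[OF primitive_unit_circle_deriv[OF H(1) u], of 2]] this]
    show "(D has_real_derivative 0) (at u)" unfolding D_def by (simp add: diff_divide_distrib)
  qed (rule that)
  have "(D \<longlongrightarrow> 0 - 0 / 2 + (pi / 2 - 0) ^ 3 / 3) (at_right 0)"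
    unfolding D_def by (intro tendsto_intros log_sine_primitive_tendsto primitive_tendsto H) simp_all
  moreover have "eventually (\<lambda>t. D t = D (pi / 6)) (at_right 0)"
    using eventually_at_right_real[of 0 "pi / 6"] by (auto elim!: eventually_mono intro: D_const)
  then have "(D \<longlongrightarrow> D (pi / 6)) (at_right 0)" by (rule tendsto_eventually)
  ultimately have "0 - 0 / 2 + (pi / 2 - 0) ^ 3 / 3 = D (pi / 6)"
    by (rule tendsto_unique[rotated]) simp
  then have "D (pi / 6) = pi ^ 3 / 24" by (simp add: power_divide)
  moreover have "D (pi / 6) = 2 * arcsin_series 3 (1 / 2) - pi ^ 3 / 324 + pi ^ 3 / 81"
    using primitive_at_sixth_root[OF H]
    by (simp add: D_def log_sine_primitive_def sin_30 power_divide field_simps power3_eq_cube)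
  ultimately have val: "2 * arcsin_series 3 (1 / 2) = 7 * pi ^ 3 / 216" by simp
  have "(\<lambda>n. 2 * (central n / (2 * real n + 1) ^ 3 * (1 / 2) ^ (2*n+1)))
      sums (2 * arcsin_series 3 (1 / 2))"
    by (intro sums_mult arcsin_series_sums) simp
  moreover have "2 * (central n / (2 * real n + 1) ^ 3 * (1 / 2) ^ (2*n+1))
      = real ((2 * n) choose n) / (2 ^ (4 * n) * (2 * real n + 1) ^ 3)" for n
    by (simp add: central_def power_mult power_divide flip: power_mult_distrib)
  ultimately show ?thesis unfolding val by simp
qed

end
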